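(* Let $\mathcal{P},\mathcal{N}\subset\mathbb{Z}_{\ge0}^2$ be finite disjoint sets with $\mathcal{P}\cup\mathcal{N}\neq\emptyset$, let $A$ be the set of P-positions of the corresponding altered Wythoff game, and let $B$ be the set of P-positions of the unaltered Wythoff game. Let $t-1$ be the largest first coordinate of an element of $\mathcal{P}\cup\mathcal{N}$. Let $c=t$, let $r$ be the number of integers $y$ such that $(x,y)\in A$ for some $x\le t-1$, and let $d$ be the number of integers $k$ such that $(x,y)\in A$ for some $x\le t-1$ with $y-x=k$ (i.e. the number of diagonals of slope $1$ containing a P-position in columns $0,\dots,t-1$). Then $A_{(d-c,\,d-r)}$ is asymptotically equal to $B$.
   Context: Wythoff's game: a position is a pair $(x,y)$ of non-negative integers; the first coordinate $x$ is the column and $y$ the row. A move from $(x,y)$ goes to $(x-k,y)$, $(x,y-k)$ or $(x-k,y-k)$ for some integer $k\ge1$, provided the resulting coordinates are non-negative. An altered Wythoff game is given by finite disjoint sets $\mathcal{P},\mathcal{N}\subset\mathbb{Z}_{\ge0}^2$; positions are labelled by recursion on $x+y$: positions in $\mathcal{P}$ are P, positions in $\mathcal{N}$ are N, and any other position is P if no position reachable from it in one move is labelled P, and N otherwise. The set of P-positions is the set of positions labelled P. The unaltered game is $\mathcal{P}=\mathcal{N}=\emptyset$; its P-positions are $B=\{(\lfloor\phi n\rfloor,\lfloor\phi^2 n\rfloor):n\ge0\}\cup\{(\lfloor\phi^2 n\rfloor,\lfloor\phi n\rfloor):n\ge0\}$, $\phi=(1+\sqrt5)/2$. For $S\subseteq\mathbb{Z}^2$,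 $S_{(\Delta x,\Delta y)}=\{(x+\Delta x,y+\Delta y):(x,y)\in S\}$. With $B_n=\{(x,y)\in\mathbb{Z}^2:x^2+y^2\le n^2\}$, infinite sets $S,T\subseteq\mathbb{Z}^2$ are asymptotically equal if $\lim_{n\to\infty}|(S\cap T)\cap B_n|/|(S\cup T)\cap B_n|=1$. *)

theory Defs
  imports Complex_Main
begin

definition moves :: "nat \<times> nat \<Rightarrow> (nat \<times> nat) set" where
  "moves p = (case p of (x, y) \<Rightarrow>
     {(x - k, y) |k. 1 \<le> k \<and> k \<le> x} \<union>
     {(x, y - k) |k. 1 \<le> k \<and> k \<le> y} \<union>
     {(x - k, y - k) |k. 1 \<le> k \<and> k \<le> x \<and> k \<le> y})"

lemma moves_decrease: "q \<in> moves p \<Longrightarrow> fst q + snd q < fst p + snd p"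
  by (auto simp: moves_def)

datatype label = PLabel | NLabel

function label_of :: "(nat \<times> nat) set \<Rightarrow> (nat \<times> nat) set \<Rightarrow> nat \<times> nat \<Rightarrow> label" where
  "label_of P N p =
     (if p \<in> P then PLabel
      else if p \<in> N then NLabel
      else if \<forall>q\<in>moves p. label_of P N q \<noteq> PLabel then PLabel
      else NLabel)"
  by pat_completeness auto
termination
  by (relation "Wellfounded.measure (\<lambda>(P, N, p). fst p + snd p)") (auto dest: moves_decrease)

declare label_of.simps [simp del]

text \<open>The P-positions are embedded in the integer lattice, where they can be translated freely.\<close>

definition P_positions :: "(nat \<times> nat) set \<Rightarrow> (nat \<times> nat) set \<Rightarrow> (int \<times> int) set" where
  "P_positions P N = {(int x, int y) |x y. label_of P N (x, y) = PLabel}"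

definition translate :: "int \<Rightarrow> int \<Rightarrow> (int \<times> int) set \<Rightarrow> (int \<times> int) set" where
  "translate dx dy S = {(x + dx, y + dy) |x y. (x, y) \<in> S}"

definition disc :: "nat \<Rightarrow> (int \<times> int) set" where
  "disc n = {(x, y). x\<^sup>2 + y\<^sup>2 \<le> (int n)\<^sup>2}"

text \<open>Only infinite sets are compared. Discs of small radius may miss \<open>S \<union> T\<close>; the quotient is
  then \<open>0 / 0 = 0\<close>, which does not affect the limit.\<close>

definition asymptotically_equal :: "(int \<times> int) set \<Rightarrow> (int \<times> int) set \<Rightarrow> bool" where
  "asymptotically_equal S T \<longleftrightarrow> infinite S \<and> infinite T \<and>
     (\<lambda>n. real (card ((S \<inter> T) \<inter> disc n)) / real (card ((S \<union> T) \<inter> disc n))) \<longlonglongrightarrow> 1"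

end

theory Submission imports Defs begin

text \<open>From column \<open>t\<close> on every column contains exactly one P-position, at the least height whose row and
  diagonal are both free. Every row and every diagonal is eventually used, and the diagonals used in
  the columns left of \<open>X\<close> finally form an interval; the same holds for the diagonals used in the rows
  below \<open>Y\<close>. Counting, these intervals have \<open>d + X - c\<close> and \<open>Y + d - r\<close> elements, so after
  translation by \<open>(d - c, d - r)\<close> exactly one of the diagonals \<open>q\<close> and \<open>- p\<close> is used in the columns
  left of \<open>p + q\<close>, and exactly one in the rows below \<open>p + q\<close>. These two rules determine the positions
  recursively, by a map contracting distances to the origin, so the discrepancies between two solutions
  reproduce under this map and have density zero. The unaltered game is the case \<open>t = 0\<close>.\<close>

section \<open>Interlaced sequences\<close>

text \<open>With \<open>u q\<close> the column of the point on diagonal \<open>q\<close> and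
  \<open>v p\<close> the row of the point on diagonal \<open>- p\<close>, the first equivalence
  (column rule) puts exactly one of the two points in a column before \<open>p + q\<close>; the
  second (row rule) puts exactly one in a row below \<open>p + q\<close>.\<close>

definition interlaced :: "int \<Rightarrow> (int \<Rightarrow> int) \<Rightarrow> (int \<Rightarrow> int) \<Rightarrow> bool" where
  "interlaced K u v \<longleftrightarrow>
     (\<forall>p\<ge>K. \<forall>q\<ge>K. (u q < p + q \<longleftrightarrow> q \<le> v p) \<and> (u q < p \<longleftrightarrow> p + q \<le> v p))"

text \<open>Reflection in the main diagonal exchanges the column rule and the row rule.\<close>

lemma interlaced_sym: "interlaced K u v \<Longrightarrow> interlaced K v u"
  unfolding interlaced_def by (smt (verit) add.commute)

lemma interlaced_mono: "interlaced K u v \<Longrightarrow> K \<le> L \<Longrightarrow> interlaced L u v"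
  unfolding interlaced_def by auto

lemma interlaced_col:
  "interlaced K u v \<Longrightarrow> K \<le> p \<Longrightarrow> K \<le> q \<Longrightarrow> u q < p + q \<longleftrightarrow> q \<le> v p"
  unfolding interlaced_def by blast

lemma interlaced_row:
  "interlaced K u v \<Longrightarrow> K \<le> p \<Longrightarrow> K \<le> q \<Longrightarrow> u q < p \<longleftrightarrow> p + q \<le> v p"
  unfolding interlaced_def by blast

text \<open>Once \<open>p\<close> exceeds \<open>u K\<close>, the row rule for diagonal
  \<open>K\<close> gives \<open>p + K \<le> v p\<close>; if also \<open>q \<le> p\<close>, the
  column rule bounds \<open>u q\<close> by \<open>p + q\<close>. The smallest such \<open>p\<close>
  exceeds \<open>q\<close> by a bounded amount only.\<close>

lemma interlaced_upper:
  assumes "interlaced K u v" "0 \<le> K" "K \<le> q"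
  shows "u q \<le> 2 * q + \<bar>u K\<bar> + 1"
proof -
  define p where "p = max q (u K + 1)"
  have p: "K \<le> p" "q \<le> p" "u K < p" "p \<le> q + \<bar>u K\<bar> + 1"
    using assms by (auto simp: p_def)
  have "p + K \<le> v p"
    using interlaced_row[OF assms(1) p(1), of K] p(3) by simp
  then have "u q < p + q"
    using interlaced_col[OF assms(1) p(1) assms(3)] p(2) assms(2) by linarith
  then show ?thesis using p(4) by linarith
qed

lemma interlaced_lower:
  assumes "interlaced K u v" "K \<le> q" "v K < q"
  shows "q + K \<le> u q"
  using interlaced_col[OF assms(1) order_refl assms(2)] assms(3) by linarith

text \<open>For fixed \<open>q \<ge> K\<close> there are \<open>\<bar>u q - u' q\<bar>\<close> such
  pairs: the displacement along a diagonal is cut into unit steps, which a linear map can transport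
  and which can be counted.\<close>

definition gaps :: "int \<Rightarrow> (int \<Rightarrow> int) \<Rightarrow> (int \<Rightarrow> int) \<Rightarrow> (int \<times> int) set" where
  "gaps K u u' = {(q, x). K \<le> q \<and> (u q < x) \<noteq> (u' q < x)}"

abbreviation gaps_below where
  "gaps_below K u u' X \<equiv> gaps K u u' \<inter> {(q, x). x < X}"

lemma finite_gaps_bounded: "finite (gaps K u u' \<inter> {(q, x). q \<le> M})"
proof -
  have "gaps K u u' \<inter> {(q, x). q \<le> M} \<subseteq>
          (SIGMA q:{K..M}. {min (u q) (u' q)..max (u q) (u' q)})"
    by (auto simp: gaps_def)
  then show ?thesis
    by (rule finite_subset) (auto intro: finite_SigmaI)
qed

text \<open>By the two halves of \<open>interlaced\<close>, the linear map \<open>(q, x) \<mapsto> (x - q, q)\<close> sends, up to a finite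
  set, the discrepancies between \<open>u\<close> and \<open>u'\<close> to those between \<open>v\<close> and \<open>v'\<close>, and back. As \<open>x\<close> is
  at most about \<open>2 q\<close>, applying it twice at least halves \<open>x\<close>.\<close>

locale interlaced_pair =
  fixes K :: int and u v u' v' :: "int \<Rightarrow> int"
  assumes K: "0 \<le> K" and il: "interlaced K u v" and il': "interlaced K u' v'"
begin

lemma swapped: "interlaced_pair K v u v' u'"
  using K il il' by (simp add: interlaced_pair_def interlaced_sym)

lemma gaps_step:
  assumes "(q, x) \<in> gaps K u u'" "K \<le> x - q"
  shows "(x - q, q) \<in> gaps K v v'"
  using assms interlaced_col[OF il, of "x - q" q] interlaced_col[OF il', of "x - q" q]
  by (auto simp: gaps_def)

text \<open>For \<open>x < q + K\<close> and large \<open>q\<close>, \<open>interlaced_lower\<close>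
  puts both \<open>u q\<close> and \<open>u' q\<close> above \<open>x\<close>, so no gap occurs.
  Hence the linear map fails at finitely many gaps only.\<close>

lemma gaps_exceptional:
  assumes "(q, x) \<in> gaps K u u'" "x - q < K"
  shows "q \<le> max (v K) (v' K)"
  using assms interlaced_lower[OF il, of q] interlaced_lower[OF il', of q]
  by (fastforce simp: gaps_def)

lemma finite_gaps_below: "finite (gaps_below K u u' X)"
proof -
  have "gaps_below K u u' X \<subseteq> gaps K u u' \<inter> {(q, x). q \<le> max X (max (v K) (v' K))}"
    using gaps_exceptional K by fastforce
  then show ?thesis
    by (rule finite_subset) (rule finite_gaps_bounded)
qed

lemma gaps_upper:
  assumes "(q, x) \<in> gaps K u u'"
  shows "x \<le> 2 * q + (\<bar>u K\<bar> + \<bar>u' K\<bar> + 1)"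
  using assms interlaced_upper[OF il K, of q] interlaced_upper[OF il' K, of q]
  by (fastforce simp: gaps_def)

lemma card_gaps_below_mono: "X \<le> Y \<Longrightarrow> card (gaps_below K u u' X) \<le> card (gaps_below K u u' Y)"
  by (rule card_mono[OF finite_gaps_below]) auto

lemma card_gaps_halving:
  "\<exists>C m. \<forall>n. card (gaps_below K u u' (int n)) \<le> m + card (gaps_below K u u' (int ((n + C) div 2 + 1)))"
proof -
  interpret s: interlaced_pair K v u v' u' by (rule swapped)
  define C where "C = nat (\<bar>u K\<bar> + \<bar>u' K\<bar> + 1)"
  define g :: "int \<times> int \<Rightarrow> int \<times> int" where "g = (\<lambda>(q, x). (x - q, q))"
  have inj_g: "inj_on g A" for A
    by (auto simp: g_def inj_on_def)
  \<comment> \<open>\<open>Z1\<close> contains the gaps at which the first application of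
    \<open>g\<close> fails, \<open>Z2\<close> those at which the second does.\<close>
  define Z1 where "Z1 = gaps K u u' \<inter> {(q, x). q \<le> max (v K) (v' K)}"
  define Z2 where "Z2 = g -` (gaps K v v' \<inter> {(q, x). q \<le> max (u K) (u' K)})"
  have fZ: "finite (Z1 \<union> Z2)"
    unfolding Z1_def Z2_def by (intro finite_UnI finite_gaps_bounded finite_vimageI inj_g)
  have "card (gaps_below K u u' (int n)) \<le>
          card (Z1 \<union> Z2) + card (gaps_below K u u' (int ((n + C) div 2 + 1)))" for n
  proof -
    let ?A = "gaps_below K u u' (int n)" and ?B = "gaps_below K u u' (int ((n + C) div 2 + 1))"
    have "(g \<circ> g) ` (?A - (Z1 \<union> Z2)) \<subseteq> ?B"
    proof (rule image_subsetI)
      fix z assume z: "z \<in> ?A - (Z1 \<union> Z2)"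
      obtain q x where qx: "z = (q, x)" by (cases z)
      with z have A: "(q, x) \<in> gaps K u u'" "x < int n" "(q, x) \<notin> Z1 \<union> Z2" by auto
      have 1: "K \<le> x - q"
        using gaps_exceptional[OF A(1)] A unfolding Z1_def by fastforce
      have E: "(x - q, q) \<in> gaps K v v'" by (rule gaps_step[OF A(1) 1])
      have 2: "K \<le> q - (x - q)"
        using s.gaps_exceptional[OF E] A E unfolding Z2_def g_def by fastforce
      have F: "(q - (x - q), x - q) \<in> gaps K u u'" by (rule s.gaps_step[OF E 2])
      have "x \<le> 2 * q + int C" using gaps_upper[OF A(1)] by (simp add: C_def)
      then have "x - q < int ((n + C) div 2 + 1)" using A(2) by linarith
      then show "(g \<circ> g) z \<in> ?B" using F by (simp add: g_def qx)
    qed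
    then have "card (?A - (Z1 \<union> Z2)) \<le> card ?B"
      using card_inj_on_le[of "g \<circ> g" "?A - (Z1 \<union> Z2)" ?B] comp_inj_on[OF inj_g inj_g] finite_gaps_below
      by blast
    moreover have "card ?A \<le> card (Z1 \<union> Z2) + card (?A - (Z1 \<union> Z2))"
    proof -
      have "card ?A \<le> card ((Z1 \<union> Z2) \<union> (?A - (Z1 \<union> Z2)))"
        using fZ finite_gaps_below by (intro card_mono) auto
      also have "\<dots> \<le> card (Z1 \<union> Z2) + card (?A - (Z1 \<union> Z2))" by (rule card_Un_le)
      finally show ?thesis .
    qed
    ultimately show ?thesis by linarith
  qed
  then show ?thesis by blast
qed

text \<open>Each halving of the argument costs a constant, so the count is in fact logarithmic; a
  linear bound of arbitrarily small slope suffices for density zero.\<close>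

lemma card_gaps_sublinear:
  assumes "0 < e"
  shows "\<exists>b. \<forall>n. real (card (gaps_below K u u' (int n))) \<le> e * real n + b"
proof -
  let ?F = "\<lambda>n. card (gaps_below K u u' (int n))"
  obtain C m where Cm: "\<And>n. ?F n \<le> m + ?F ((n + C) div 2 + 1)"
    using card_gaps_halving by blast
  \<comment> \<open>The first bound makes the halved argument \<open>k\<close> smaller than
    \<open>n\<close>; the second makes \<open>e * (n - k)\<close> at least \<open>m\<close>, which
    absorbs the additive constant.\<close>
  define L where "L = max (C + 3) (nat \<lceil>2 * (real m / e) + real C + 2\<rceil>)"
  have "real (?F n) \<le> e * real n + real (?F L)" for n
  proof (induction n rule: less_induct)
    case (less n)
    show ?case
    proof (cases "n < L")
      case True
      then have "?F n \<le> ?F L" by (intro card_gaps_below_mono) simp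
      moreover have "0 \<le> e * real n" using assms by simp
      ultimately show ?thesis by linarith
    next
      case False
      define k where "k = (n + C) div 2 + 1"
      have "C + 3 \<le> n" using False unfolding L_def by simp
      then have k: "k < n" unfolding k_def by linarith
      have "2 * k \<le> n + C + 2" unfolding k_def by presburger
      then have "real (2 * k) \<le> real (n + C + 2)" by (rule of_nat_mono)
      then have kn: "real k \<le> (real n + real C) / 2 + 1" by (simp add: field_simps)
      have n: "2 * (real m / e) + real C + 2 \<le> real n"
        using False unfolding L_def by linarith
      have "real m = e * (real m / e)" using assms by simp
      also have "\<dots> \<le> e * (real n - ((real n + real C) / 2 + 1))"
        using assms n by (intro mult_left_mono) (auto simp: field_simps)
      also have "\<dots> \<le> e * (real n - real k)"
        using assms kn by (intro mult_left_mono) auto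
      finally have "real m + e * real k \<le> e * real n" by (simp add: algebra_simps)
      moreover have "real (?F n) \<le> real m + real (?F k)" using Cm[of n] unfolding k_def by linarith
      ultimately show ?thesis using less.IH[OF k] by linarith
    qed
  qed
  then show ?thesis by blast
qed

end

section \<open>Asymptotic equality of point sets with interlaced tails\<close>

text \<open>\<open>u q\<close> is the column of the point of \<open>S\<close> on the diagonal \<open>q\<close>, and \<open>v p\<close> is the row of the
  point on the diagonal \<open>- p\<close>.\<close>

definition interlaced_tails :: "int \<Rightarrow> (int \<Rightarrow> int) \<Rightarrow> (int \<Rightarrow> int) \<Rightarrow> (int \<times> int) set \<Rightarrow> bool" where
  "interlaced_tails K u v S \<longleftrightarrow> 0 \<le> K \<and> interlaced K u v \<and>
     (\<forall>q\<ge>K. \<forall>x. (x, x + q) \<in> S \<longleftrightarrow> x = u q) \<and>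
     (\<forall>p\<ge>K. \<forall>y. (y + p, y) \<in> S \<longleftrightarrow> y = v p) \<and>
     (\<forall>k. finite {x. (x, x + k) \<in> S})"

lemma interlaced_tails_mono:
  "interlaced_tails K u v S \<Longrightarrow> K \<le> L \<Longrightarrow> interlaced_tails L u v S"
  unfolding interlaced_tails_def using interlaced_mono by auto

lemma finite_band:
  assumes "\<And>k. finite {x. (x, x + k) \<in> S}"
  shows "finite (S \<inter> {(x, y). \<bar>y - x\<bar> < (K::int)})"
proof -
  have "S \<inter> {(x, y). \<bar>y - x\<bar> < K} \<subseteq> (\<Union>k\<in>{-K..K}. (\<lambda>x. (x, x + k)) ` {x. (x, x + k) \<in> S})"
  proof clarify
    fix x y assume "(x, y) \<in> S" "\<bar>y - x\<bar> < K"
    then have "y - x \<in> {-K..K}" "(x, y) = (x, x + (y - x))" "x \<in> {x'. (x', x' + (y - x)) \<in> S}" by auto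
    then show "(x, y) \<in> (\<Union>k\<in>{-K..K}. (\<lambda>x. (x, x + k)) ` {x. (x, x + k) \<in> S})" by blast
  qed
  then show ?thesis using assms by (auto intro: finite_subset)
qed

lemma disc_bound:
  assumes "(x, y) \<in> disc n" shows "\<bar>x\<bar> \<le> int n" "\<bar>y\<bar> \<le> int n"
proof -
  have "x\<^sup>2 + y\<^sup>2 \<le> (int n)\<^sup>2" using assms by (simp add: disc_def)
  then have "x\<^sup>2 \<le> (int n)\<^sup>2" "y\<^sup>2 \<le> (int n)\<^sup>2"
    using zero_le_power2[of x] zero_le_power2[of y] by linarith+
  then show "\<bar>x\<bar> \<le> int n" "\<bar>y\<bar> \<le> int n"
    by (auto dest: abs_le_square_iff[THEN iffD2, of _ "int n"])
qed

lemma finite_disc: "finite (disc n)"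
proof (rule finite_subset)
  show "disc n \<subseteq> {- int n..int n} \<times> {- int n..int n}"
    using disc_bound by fastforce
qed simp

lemma disc_intro:
  assumes "0 \<le> x" "0 \<le> y" "x + y \<le> int n" shows "(x, y) \<in> disc n"
proof -
  have "x\<^sup>2 + y\<^sup>2 \<le> (x + y)\<^sup>2" using assms by (simp add: power2_sum)
  also have "\<dots> \<le> (int n)\<^sup>2" using assms by (intro power_mono) auto
  finally show ?thesis by (simp add: disc_def)
qed

text \<open>Outside a band around the main diagonal, a point of \<open>S\<close> missing from
  \<open>S'\<close> is displaced along its diagonal and so produces a gap. The band holds finitely
  many points.\<close>

lemma interlaced_tails_diff:
  assumes S: "interlaced_tails K u v S" and S': "interlaced_tails K u' v' S'" and e: "0 < e"
  shows "\<exists>b. \<forall>n. real (card ((S - S') \<inter> disc n)) \<le> e * real n + b"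
proof -
  interpret interlaced_pair K u v u' v'
    using S S' unfolding interlaced_tails_def by unfold_locales auto
  interpret s: interlaced_pair K v u v' u' by (rule swapped)
  have e2: "0 < e / 2" using e by simp
  obtain b1 where b1: "\<And>n. real (card (gaps_below K u u' (int n))) \<le> e / 2 * real n + b1"
    using card_gaps_sublinear[OF e2] by blast
  obtain b2 where b2: "\<And>n. real (card (gaps_below K v v' (int n))) \<le> e / 2 * real n + b2"
    using s.card_gaps_sublinear[OF e2] by blast
  define Z where "Z = S \<inter> {(x, y). \<bar>y - x\<bar> < K}"
  have fZ: "finite Z"
    unfolding Z_def using S by (intro finite_band) (simp add: interlaced_tails_def)
  have u: "(x, x + q) \<in> S \<longleftrightarrow> x = u q" "(x, x + q) \<in> S' \<longleftrightarrow> x = u' q" if "K \<le> q" for x q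
    using S S' that unfolding interlaced_tails_def by auto
  have v: "(y + p, y) \<in> S \<longleftrightarrow> y = v p" "(y + p, y) \<in> S' \<longleftrightarrow> y = v' p" if "K \<le> p" for y p
    using S S' that unfolding interlaced_tails_def by auto
  \<comment> \<open>The gap used for a point of the disc has second coordinate at most
    \<open>n + 1\<close>, hence the strict bound \<open>n + 2\<close>; this shift in both counts
    costs \<open>2 * e\<close>.\<close>
  have "real (card ((S - S') \<inter> disc n)) \<le> e * real n + (real (card Z) + 2 * e + b1 + b2)" for n
  proof -
    let ?U = "(\<lambda>(q, x). (u q, u q + q)) ` gaps_below K u u' (int (n + 2))"
    let ?V = "(\<lambda>(p, y). (v p + p, v p)) ` gaps_below K v v' (int (n + 2))"
    have "(S - S') \<inter> disc n \<subseteq> Z \<union> (?U \<union> ?V)"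
    proof (rule subsetI)
      fix z assume z: "z \<in> (S - S') \<inter> disc n"
      obtain x y where xy: "z = (x, y)" by (cases z)
      have le: "x \<le> int n" "y \<le> int n" using z xy disc_bound[of x y n] by auto
      consider "\<bar>y - x\<bar> < K" | "K \<le> y - x" | "K \<le> x - y" by linarith
      then show "z \<in> Z \<union> (?U \<union> ?V)"
      proof cases
        case 1
        then show ?thesis using z xy unfolding Z_def by auto
      next
        case 2
        have ux: "x = u (y - x)" "x \<noteq> u' (y - x)"
          using u[OF 2, of x] z xy by auto
        \<comment> \<open>The least gap on this diagonal is one past the smaller of the two
          columns.\<close>
        then have "(y - x, min x (u' (y - x)) + 1) \<in> gaps_below K u u' (int (n + 2))"
          using 2 le by (auto simp: gaps_def)
        moreover have "(\<lambda>(q, x). (u q, u q + q)) (y - x, min x (u' (y - x)) + 1) = z"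
          using ux xy by simp
        ultimately show ?thesis by (metis (no_types, lifting) UnI1 UnI2 imageI)
      next
        case 3
        have vy: "y = v (x - y)" "y \<noteq> v' (x - y)"
          using v[OF 3, of y] z xy by auto
        then have "(x - y, min y (v' (x - y)) + 1) \<in> gaps_below K v v' (int (n + 2))"
          using 3 le by (auto simp: gaps_def)
        moreover have "(\<lambda>(p, y). (v p + p, v p)) (x - y, min y (v' (x - y)) + 1) = z"
          using vy xy by simp
        ultimately show ?thesis by (metis (no_types, lifting) UnI1 UnI2 imageI)
      qed
    qed
    then have "card ((S - S') \<inter> disc n) \<le> card (Z \<union> (?U \<union> ?V))"
      using fZ finite_gaps_below s.finite_gaps_below by (intro card_mono) auto
    also have "\<dots> \<le> card Z + (card ?U + card ?V)"
      by (meson add_le_mono card_Un_le le_refl le_trans)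
    also have "\<dots> \<le> card Z + (card (gaps_below K u u' (int (n + 2))) + card (gaps_below K v v' (int (n + 2))))"
      by (intro add_mono card_image_le finite_gaps_below s.finite_gaps_below order_refl)
    finally have "card ((S - S') \<inter> disc n) \<le> \<dots>" .
    then show ?thesis using b1[of "n + 2"] b2[of "n + 2"] by (simp add: algebra_simps)
  qed
  then show ?thesis by blast
qed

text \<open>By \<open>interlaced_upper\<close> the coordinate sum \<open>2 * u q + q\<close> is at
  most \<open>5 * q + 2 * C\<close>, so the diagonals up to about \<open>n / 5\<close> each
  contribute a point of the disc; starting at \<open>L\<close> keeps the coordinates
  non-negative.\<close>

lemma interlaced_tails_growth:
  assumes S: "interlaced_tails K u v S"
  shows "\<exists>b. \<forall>n. real n / 5 - b \<le> real (card (S \<inter> disc n))"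
proof -
  have K: "0 \<le> K" and il: "interlaced K u v"
    and u: "\<And>x q. K \<le> q \<Longrightarrow> (x, x + q) \<in> S \<longleftrightarrow> x = u q"
    using S unfolding interlaced_tails_def by auto
  define C where "C = \<bar>u K\<bar> + 1"
  define L where "L = max K (v K + 1)"
  have "real n / 5 - (2 * C + L + 1) \<le> real (card (S \<inter> disc n))" for n
  proof -
    let ?I = "{L..(int n - 2 * C) div 5}"
    have "(\<lambda>q. (u q, u q + q)) ` ?I \<subseteq> S \<inter> disc n"
    proof (rule image_subsetI)
      fix q assume q: "q \<in> ?I"
      then have "K \<le> q" "v K < q" "5 * q \<le> int n - 2 * C" by (auto simp: L_def)
      then have "0 \<le> u q" "u q \<le> 2 * q + C" "0 \<le> q" "(u q, u q + q) \<in> S"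
        using interlaced_lower[OF il, of q] interlaced_upper[OF il K, of q] u K by (auto simp: C_def)
      then show "(u q, u q + q) \<in> S \<inter> disc n"
        using \<open>5 * q \<le> int n - 2 * C\<close> by (auto intro!: disc_intro)
    qed
    moreover have "inj_on (\<lambda>q. (u q, u q + q)) ?I" by (auto simp: inj_on_def)
    ultimately have "card ?I \<le> card (S \<inter> disc n)"
      using finite_disc by (intro card_inj_on_le) auto
    moreover have "real n / 5 - (2 * C + L + 1) \<le> real (card ?I)"
    proof -
      have "0 \<le> C" by (simp add: C_def)
      define z where "z = card ?I"
      define m where "m = (int n - 2 * C) div 5"
      have "int n - 2 * C - 5 \<le> 5 * m" unfolding m_def by presburger
      moreover have "m + 1 - L \<le> int z" by (simp add: m_def z_def)
      ultimately have "int n - (10 * C + 5 * L + 5) \<le> 5 * int z"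
        using \<open>0 \<le> C\<close> by linarith
      then have "real_of_int (int n - (10 * C + 5 * L + 5)) \<le> real_of_int (5 * int z)"
        by (simp only: of_int_le_iff)
      then show ?thesis unfolding z_def[symmetric] by (simp add: field_simps)
    qed
    ultimately show ?thesis by linarith
  qed
  then show ?thesis by blast
qed

lemma interlaced_tails_infinite:
  assumes "interlaced_tails K u v S" shows "infinite S"
proof
  assume "finite S"
  moreover have "(\<lambda>q. (u q, u q + q)) ` {K..} \<subseteq> S"
    using assms unfolding interlaced_tails_def by auto
  moreover have "inj_on (\<lambda>q. (u q, u q + q)) {K..}" by (auto simp: inj_on_def)
  ultimately have "finite {K..}" by (metis finite_subset finite_imageD)
  then show False using infinite_Ici by blast
qed

lemma interlaced_tails_asymptotically_equal:
  assumes "interlaced_tails K u v S" "interlaced_tails L u' v' T"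
  shows "asymptotically_equal S T"
proof -
  define M where "M = max K L"
  have S: "interlaced_tails M u v S" and T: "interlaced_tails M u' v' T"
    using assms interlaced_tails_mono unfolding M_def by auto
  let ?I = "\<lambda>n. real (card ((S \<inter> T) \<inter> disc n))"
  let ?U = "\<lambda>n. real (card ((S \<union> T) \<inter> disc n))"
  obtain b where b: "\<And>n. real n / 5 - b \<le> real (card (S \<inter> disc n))"
    using interlaced_tails_growth[OF S] by blast
  have Ub: "real n / 5 - b \<le> ?U n" for n
  proof -
    have "card (S \<inter> disc n) \<le> card ((S \<union> T) \<inter> disc n)"
      using finite_disc by (intro card_mono) auto
    then show ?thesis using b[of n] by linarith
  qed
  have UI: "?U n = ?I n + real (card ((S - T) \<inter> disc n)) + real (card ((T - S) \<inter> disc n))" for n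
  proof -
    have "(S \<union> T) \<inter> disc n = ((S \<inter> T) \<inter> disc n) \<union> (((S - T) \<inter> disc n) \<union> ((T - S) \<inter> disc n))" by auto
    moreover have "card \<dots> = card ((S \<inter> T) \<inter> disc n) + card (((S - T) \<inter> disc n) \<union> ((T - S) \<inter> disc n))"
      using finite_disc by (intro card_Un_disjoint) auto
    moreover have "card (((S - T) \<inter> disc n) \<union> ((T - S) \<inter> disc n)) = card ((S - T) \<inter> disc n) + card ((T - S) \<inter> disc n)"
      using finite_disc by (intro card_Un_disjoint) auto
    ultimately show ?thesis by simp
  qed
  have "(\<lambda>n. ?I n / ?U n) \<longlonglongrightarrow> 1"
  proof (rule LIMSEQ_I)
    fix e :: real assume e: "0 < e"
    \<comment> \<open>Chosen so that \<open>4 * d * n\<close> is half of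
      \<open>e * (n / 10)\<close>.\<close>
    define d where "d = e / 80"
    have d: "0 < d" using e by (simp add: d_def)
    obtain b1 where b1: "\<And>n. real (card ((S - T) \<inter> disc n)) \<le> d * real n + b1"
      using interlaced_tails_diff[OF S T d] by blast
    obtain b2 where b2: "\<And>n. real (card ((T - S) \<inter> disc n)) \<le> d * real n + b2"
      using interlaced_tails_diff[OF T S d] by blast
    \<comment> \<open>Beyond \<open>n0\<close> the offsets are absorbed: the union has at least
      \<open>n / 10\<close> points, the symmetric difference at most
      \<open>4 * d * n\<close>.\<close>
    define n0 where "n0 = nat \<lceil>max 1 (max (10 * b) ((b1 + b2) / (2 * d)))\<rceil>"
    have "norm (?I n / ?U n - 1) < e" if "n0 \<le> n" for n
    proof -
      have n: "1 \<le> real n" "10 * b \<le> real n" "(b1 + b2) / (2 * d) \<le> real n"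
        using that unfolding n0_def by linarith+
      have U: "real n / 10 \<le> ?U n" using Ub[of n] n by linarith
      then have U0: "0 < ?U n" using n by linarith
      have "b1 + b2 \<le> 2 * d * real n" using n(3) d by (simp add: field_simps)
      then have "?U n - ?I n \<le> 4 * d * real n" using UI[of n] b1[of n] b2[of n] by linarith
      also have "\<dots> = e / 2 * (real n / 10)" by (simp add: d_def)
      also have "\<dots> \<le> e / 2 * ?U n" using U e by (intro mult_left_mono) auto
      also have "\<dots> < e * ?U n" using U0 e by simp
      finally have "(?U n - ?I n) / ?U n < e" using U0 by (simp add: divide_less_eq)
      moreover have "?I n / ?U n - 1 = - ((?U n - ?I n) / ?U n)" using U0 by (simp add: field_simps)
      moreover have "0 \<le> (?U n - ?I n) / ?U n" using UI[of n] by simp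
      ultimately show ?thesis by simp
    qed
    then show "\<exists>n0. \<forall>n\<ge>n0. norm (?I n / ?U n - 1) < e" by blast
  qed
  then show ?thesis
    using interlaced_tails_infinite[OF S] interlaced_tails_infinite[OF T]
    unfolding asymptotically_equal_def by blast
qed

section \<open>Greedy placement\<close>

lemma atLeastLessThan_Suc_int: "(t::int) \<le> x \<Longrightarrow> {t..<x + 1} = insert x {t..<x}"
  by auto

text \<open>The length forces \<open>b - a = p + q - 1\<close>, so \<open>q \<le> b\<close> holds
  exactly when \<open>- p < a\<close>; the inequalities at the other ends follow from
  \<open>0\<close> lying in the interval.\<close>

lemma interval_exactly_one:
  assumes "{a..b} = S" "(0::int) \<in> S" "int (card S) = p + q" "0 < p" "0 < q"
  shows "q \<in> S \<longleftrightarrow> - p \<notin> S"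
proof -
  have "a \<le> 0" "0 \<le> b" using assms by auto
  then have "b - a + 1 = p + q" using assms by auto
  then show ?thesis using assms \<open>a \<le> 0\<close> \<open>0 \<le> b\<close> by auto
qed

text \<open>\<open>R0\<close> and \<open>D0\<close> are the rows and diagonals already taken before column \<open>t\<close>; in each column
  \<open>x \<ge> t\<close>, \<open>w x\<close> is the least height whose row and diagonal are both free.\<close>

locale greedy =
  fixes t :: int and R0 D0 :: "int set" and w :: "int \<Rightarrow> int"
  assumes t_nonneg: "0 \<le> t"
    and finite_R0: "finite R0" and finite_D0: "finite D0"
    and R0_nonneg: "y \<in> R0 \<Longrightarrow> 0 \<le> y"
    and R0_D0: "y \<in> R0 \<Longrightarrow> \<exists>k\<in>D0. y < t + k"
    and w_nonneg: "t \<le> x \<Longrightarrow> 0 \<le> w x"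
    and w_row: "t \<le> x \<Longrightarrow> w x \<notin> R0 \<union> w ` {t..<x}"
    and w_diag: "t \<le> x \<Longrightarrow> w x - x \<notin> D0 \<union> (\<lambda>x'. w x' - x') ` {t..<x}"
    and w_least: "t \<le> x \<Longrightarrow> 0 \<le> y \<Longrightarrow> y \<notin> R0 \<union> w ` {t..<x} \<Longrightarrow>
      y - x \<notin> D0 \<union> (\<lambda>x'. w x' - x') ` {t..<x} \<Longrightarrow> w x \<le> y"
begin

definition R :: "int \<Rightarrow> int set" where "R x = R0 \<union> w ` {t..<x}"
definition D :: "int \<Rightarrow> int set" where "D x = D0 \<union> (\<lambda>x'. w x' - x') ` {t..<x}"

lemma finite_R: "finite (R x)" and finite_D: "finite (D x)"
  using finite_R0 finite_D0 by (auto simp: R_def D_def)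

lemma R_nonneg: "y \<in> R x \<Longrightarrow> 0 \<le> y"
  using R0_nonneg w_nonneg by (auto simp: R_def)

lemma R_mono: "x \<le> x' \<Longrightarrow> R x \<subseteq> R x'" and D_mono: "x \<le> x' \<Longrightarrow> D x \<subseteq> D x'"
  by (auto simp: R_def D_def)

lemma w_notin_R: "t \<le> x \<Longrightarrow> w x \<notin> R x" and diag_notin_D: "t \<le> x \<Longrightarrow> w x - x \<notin> D x"
  using w_row w_diag unfolding R_def D_def by blast+

lemma least: "t \<le> x \<Longrightarrow> 0 \<le> y \<Longrightarrow> y \<notin> R x \<Longrightarrow> y - x \<notin> D x \<Longrightarrow> w x \<le> y"
  using w_least unfolding R_def D_def by blast

lemma R_Suc: "t \<le> x \<Longrightarrow> R (x + 1) = insert (w x) (R x)"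
  and D_Suc: "t \<le> x \<Longrightarrow> D (x + 1) = insert (w x - x) (D x)"
  by (auto simp: R_def D_def atLeastLessThan_Suc_int)

lemma w_in_R: "t \<le> x \<Longrightarrow> x < x' \<Longrightarrow> w x \<in> R x'"
  and diag_in_D: "t \<le> x \<Longrightarrow> x < x' \<Longrightarrow> w x - x \<in> D x'"
  by (auto simp: R_def D_def)

lemma R_new:
  assumes "y \<in> R x'" "y \<notin> R x"
  obtains z where "t \<le> z" "x \<le> z" "z < x'" "y = w z"
proof -
  obtain z where z: "t \<le> z" "z < x'" "y = w z" using assms by (auto simp: R_def)
  then have "x \<le> z" using assms(2) w_in_R[of z x] by force
  then show thesis using z that by blast
qed

lemma D_new:
  assumes "k \<in> D x'" "k \<notin> D x"
  obtains z where "t \<le> z" "x \<le> z" "z < x'" "k = w z - z"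
proof -
  obtain z where z: "t \<le> z" "z < x'" "k = w z - z" using assms by (auto simp: D_def)
  then have "x \<le> z" using assms(2) diag_in_D[of z x] by force
  then show thesis using z that by blast
qed

lemma w_eq_iff: "t \<le> x \<Longrightarrow> t \<le> x' \<Longrightarrow> w x = w x' \<longleftrightarrow> x = x'"
  by (metis linorder_neqE w_in_R w_notin_R)

lemma diag_eq_iff: "t \<le> x \<Longrightarrow> t \<le> x' \<Longrightarrow> w x - x = w x' - x' \<longleftrightarrow> x = x'"
  by (metis linorder_neqE diag_in_D diag_notin_D)

lemma card_R: "t \<le> x \<Longrightarrow> int (card (R x)) = int (card R0) + (x - t)"
proof (induction x rule: int_ge_induct)
  case base then show ?case by (simp add: R_def)
next
  case (step x) then show ?case using w_notin_R by (simp add: R_Suc finite_R)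
qed

lemma card_D: "t \<le> x \<Longrightarrow> int (card (D x)) = int (card D0) + (x - t)"
proof (induction x rule: int_ge_induct)
  case base then show ?case by (simp add: D_def)
next
  case (step x) then show ?case using diag_notin_D by (simp add: D_Suc finite_D)
qed

section \<open>Every row and every diagonal is eventually used\<close>

lemma rows_used: "\<exists>x\<ge>t. {0..<int n} \<subseteq> R x"
proof (induction n)
  case 0 then show ?case by auto
next
  case (Suc n)
  then obtain x1 where x1: "t \<le> x1" "{0..<int n} \<subseteq> R x1" by blast
  obtain l where l: "\<And>k. k \<in> D x1 \<Longrightarrow> l \<le> k"
    using finite_D by (meson bdd_below.E bdd_below_finite)
  have ge: "int n \<le> w x" if "x1 \<le> x" for x
  proof (rule ccontr)
    assume "\<not> int n \<le> w x"
    then have "w x \<in> {0..<int n}" using w_nonneg x1 that by auto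
    then show False using x1 that R_mono[OF that] w_notin_R[of x] by auto
  qed
  \<comment> \<open>In this column row \<open>n\<close> meets a diagonal below \<open>l\<close>,
    hence below all of \<open>D x1\<close>. The choices in columns from \<open>x1\<close> to before
    \<open>x\<close> have height at least \<open>n\<close> and lie further left, so their diagonals
    are higher: only the row itself can be taken.\<close>
  define x where "x = max x1 (int n - l + 1)"
  have x: "t \<le> x" "x1 \<le> x" "int n - x < l" using x1 by (auto simp: x_def)
  have "int n \<in> R (x + 1)"
  proof (cases "int n \<in> R x")
    case True then show ?thesis using R_mono[of x "x + 1"] by auto
  next
    case False
    have "int n - x \<notin> D x"
    proof
      assume "int n - x \<in> D x"
      moreover have "int n - x \<notin> D x1" using l x(3) by force
      ultimately obtain x' where "x1 \<le> x'" "x' < x" "int n - x = w x' - x'"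
        using D_new by metis
      then show False using ge[of x'] by linarith
    qed
    then have "w x \<le> int n" using least[OF x(1) _ False] by simp
    then have "w x = int n" using ge[OF x(2)] by simp
    then show ?thesis using R_Suc[OF x(1)] by simp
  qed
  moreover have "{0..<int n} \<subseteq> R (x + 1)"
    using x1(2) R_mono[of x1 "x + 1"] x(2) by force
  moreover have "{0..<int (Suc n)} = insert (int n) {0..<int n}" by auto
  ultimately show ?case using x(1) by (intro exI[of _ "x + 1"]) auto
qed

text \<open>If the diagonal \<open>k\<close> stays free, a choice above it in column \<open>X\<close> is only possible when the row
  \<open>X + k\<close> is taken, so the number of taken rows above the diagonal (the set \<open>pend\<close>) cannot grow, and
  all but boundedly many rows below it are taken. On the other hand diagonals are never reused, so
  late choices avoid a wide strip around the diagonal \<open>k\<close>, which leaves many rows free.\<close>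

lemma diag_used: "\<exists>x\<ge>t. k \<in> D x"
proof (rule ccontr)
  assume "\<not> ?thesis"
  then have unused: "k \<notin> D x" if "t \<le> x" for x using that by blast
  define pend where "pend X = {y \<in> R X. X + k \<le> y}" for X
  have fin: "finite (pend X)" for X using finite_R by (simp add: pend_def)
  \<comment> \<open>From \<open>T0\<close> on, diagonal \<open>k\<close> meets each column in a
    non-negative row, so its square is a legal choice unless its row is taken.\<close>
  define T0 where "T0 = max t (- k)"
  define J where "J = card (pend T0)"
  have J: "card (pend X) \<le> J" if "T0 \<le> X" for X
    using that
  proof (induction X rule: int_ge_induct)
    case base then show ?case by (simp add: J_def)
  next
    case (step X)
    then have X: "t \<le> X" "0 \<le> X + k" by (auto simp: T0_def)
    have ne: "w X \<noteq> X + k"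
      using unused[of "X + 1"] X D_Suc[OF X(1)] by auto
    have "card (pend (X + 1)) \<le> card (pend X)"
    proof (cases "w X < X + k")
      case True
      then have "pend (X + 1) \<subseteq> pend X" by (auto simp: pend_def R_Suc[OF X(1)])
      then show ?thesis by (rule card_mono[OF fin])
    next
      case False
      then have "X + k \<in> R X"
        using least[OF X] unused[OF X(1)] ne by force
      then have 1: "X + k \<in> pend X" by (simp add: pend_def)
      \<comment> \<open>The threshold rises with the column, so row \<open>X + k\<close> drops out
        and makes up for the new row \<open>w X\<close>.\<close>
      have "pend (X + 1) \<subseteq> insert (w X) (pend X - {X + k})"
        by (auto simp: pend_def R_Suc[OF X(1)])
      then have "card (pend (X + 1)) \<le> card (insert (w X) (pend X - {X + k}))"
        using fin by (intro card_mono) auto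
      also have "\<dots> \<le> Suc (card (pend X - {X + k}))" by (rule card_insert_le_m1) auto
      also have "\<dots> = card (pend X)" using 1 fin by (metis card_Suc_Diff1)
      finally show ?thesis .
    qed
    then show ?case using step by linarith
  qed
  \<comment> \<open>Before column \<open>X + M\<close> at least \<open>X + M - t\<close> rows are
    taken, but at most \<open>X + k + 2 * J\<close> can be; this \<open>M\<close> makes the two
    incompatible.\<close>
  define M where "M = \<bar>k\<bar> + t + 2 * int J + 1"
  have M: "0 < M" using t_nonneg by (simp add: M_def)
  have "finite {x. t \<le> x \<and> \<bar>w x - x - k\<bar> < M}"
  proof (rule finite_imageD)
    show "finite ((\<lambda>x. w x - x) ` {x. t \<le> x \<and> \<bar>w x - x - k\<bar> < M})"
      by (rule finite_subset[of _ "{k - M..k + M}"]) auto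
    show "inj_on (\<lambda>x. w x - x) {x. t \<le> x \<and> \<bar>w x - x - k\<bar> < M}"
      using diag_eq_iff by (auto simp: inj_on_def)
  qed
  then obtain U where U: "\<And>x. t \<le> x \<Longrightarrow> \<bar>w x - x - k\<bar> < M \<Longrightarrow> x \<le> U"
    by (metis (mono_tags, lifting) bdd_above.E bdd_above_finite mem_Collect_eq)
  define X where "X = max T0 (U + 1)"
  have X: "T0 \<le> X" "t \<le> X" "0 \<le> X + k" "U < X" by (auto simp: X_def T0_def)
  have far: "w x < X + k \<or> X + k + M \<le> w x" if "X \<le> x" "x < X + M" for x
    using U[of x] that X by linarith
  have "R (X + M) \<subseteq> {0..<X + k} \<union> (pend X \<union> pend (X + M))"
  proof
    fix y assume y: "y \<in> R (X + M)"
    show "y \<in> {0..<X + k} \<union> (pend X \<union> pend (X + M))"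
    proof (cases "y \<in> R X")
      case True
      then show ?thesis using R_nonneg[OF y] by (auto simp: pend_def)
    next
      case False
      then obtain x where "X \<le> x" "x < X + M" "y = w x"
        using R_new[OF y] by blast
      then show ?thesis using far[of x] R_nonneg[OF y] y by (auto simp: pend_def)
    qed
  qed
  then have "card (R (X + M)) \<le> card ({0..<X + k} \<union> (pend X \<union> pend (X + M)))"
    using fin by (intro card_mono) auto
  also have "\<dots> \<le> card {0..<X + k} + (card (pend X) + card (pend (X + M)))"
    by (meson add_le_mono card_Un_le le_refl le_trans)
  also have "\<dots> \<le> card {0..<X + k} + (J + J)"
    using J[of X] J[of "X + M"] X M by simp
  finally have "int (card (R (X + M))) \<le> X + k + 2 * int J" using X by simp
  then show False using card_R[of "X + M"] X M by (simp add: M_def)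
qed

lemma diags_used: "finite F \<Longrightarrow> \<exists>x\<ge>t. F \<subseteq> D x"
proof (induction F rule: finite_induct)
  case (insert k F)
  then obtain x where x: "t \<le> x" "F \<subseteq> D x" by blast
  obtain x' where "t \<le> x'" "k \<in> D x'" using diag_used by blast
  then show ?case
    using x D_mono[of x "max x x'"] D_mono[of x' "max x x'"]
    by (intro exI[of _ "max x x'"]) auto
qed auto

section \<open>The used diagonals form an interval\<close>

lemma diag_upper:
  assumes "t < x" and b: "\<And>j. j \<in> D x \<Longrightarrow> j \<le> b"
  shows "w x - x \<le> b + 1"
proof (rule ccontr)
  assume *: "\<not> ?thesis"
  have "w t - t \<le> b" using b diag_in_D assms(1) by simp
  then have 0: "0 \<le> x + b + 1" using w_nonneg[of t] assms(1) by linarith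
  \<comment> \<open>Row \<open>x + b + 1\<close> is above all taken rows: choices before column
    \<open>x\<close> lie on diagonals at most \<open>b\<close>, and \<open>R0_D0\<close> gives the
    same for the initial rows. So the square on diagonal \<open>b + 1\<close> is free.\<close>
  have "x + b + 1 \<notin> R0"
  proof
    assume "x + b + 1 \<in> R0"
    then obtain k where "k \<in> D0" "x + b + 1 < t + k" using R0_D0 by blast
    then show False using b[of k] assms(1) by (auto simp: D_def)
  qed
  moreover have "x + b + 1 \<noteq> w x'" if "t \<le> x'" "x' < x" for x'
    using b[OF diag_in_D[OF that]] that by linarith
  ultimately have "x + b + 1 \<notin> R x" by (force simp: R_def image_iff)
  moreover have "b + 1 \<notin> D x" using b by force
  ultimately have "w x \<le> x + b + 1" using least[of x "x + b + 1"] 0 assms(1) by simp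
  then show False using * by linarith
qed

text \<open>If the choice in column \<open>x\<close> fell below diagonal \<open>a - 1\<close>, its
  row would have been free in column \<open>x - 1\<close> too, on a diagonal still below
  \<open>a\<close>. The least choice there would then lie below diagonal \<open>a\<close>, against
  the bound.\<close>

lemma diag_lower:
  assumes "t + 1 < x" and a: "\<And>j. j \<in> D x \<Longrightarrow> a \<le> j"
  shows "a - 1 \<le> w x - x"
proof (rule ccontr)
  assume *: "\<not> ?thesis"
  define z where "z = x - 1"
  have z: "t \<le> z" "x = z + 1" using assms(1) by (auto simp: z_def)
  have Dx: "D x = insert (w z - z) (D z)" using D_Suc z by simp
  have "w x \<notin> R x" "0 \<le> w x" using w_notin_R w_nonneg assms(1) by auto
  then have "w x \<notin> R z" "w x \<noteq> w z" using R_Suc z by auto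
  moreover have "w x - z \<notin> D z" using a[of "w x - z"] Dx * z by auto
  ultimately have "w z < w x" using least[OF z(1), of "w x"] \<open>0 \<le> w x\<close> by fastforce
  moreover have "a \<le> w z - z" using a Dx by simp
  ultimately show False using * z by linarith
qed

text \<open>By the two preceding bounds no new gap in the set of used diagonals arises after column
  \<open>t + 1\<close>, and old gaps are filled by \<open>diag_used\<close>.\<close>

lemma D_interval: "\<exists>T>t + 1. \<forall>x\<ge>T. \<exists>a b. D x = {a..b}"
proof -
  \<comment> \<open>From this column on both diagonal bounds apply. Together with the hull
    \<open>{lo..hi}\<close> the used diagonals form an interval at the start, and each new one lies
    in it or next to an end.\<close>
  define s where "s = t + 2"
  define lo where "lo = Min (D s)"
  define hi where "hi = Max (D s)"
  have "w t - t \<in> D s" using diag_in_D by (simp add: s_def)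
  then have ne: "D s \<noteq> {}" by blast
  have inv: "\<exists>a b. D x \<union> {lo..hi} = {a..b}" if "s \<le> x" for x
    using that
  proof (induction x rule: int_ge_induct)
    case base
    have "D s \<union> {lo..hi} = {lo..hi}" using finite_D by (auto simp: lo_def hi_def)
    then show ?case by blast
  next
    case (step x)
    then obtain a b where ab: "D x \<union> {lo..hi} = {a..b}" by blast
    have x: "t + 1 < x" using step by (simp add: s_def)
    define k where "k = w x - x"
    have 1: "a \<le> j" "j \<le> b" if "j \<in> D x" for j using that ab by fastforce+
    have k: "a - 1 \<le> k" "k \<le> b + 1"
      unfolding k_def using diag_lower[OF x 1(1)] diag_upper[of x b] 1(2) x by auto
    have "w t - t \<in> D x" using diag_in_D x by simp
    then have "a \<le> b" using 1 by fastforce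
    have "D (x + 1) \<union> {lo..hi} = insert k {a..b}" using ab D_Suc[of x] x by (auto simp: k_def)
    also have "\<dots> = {min a k..max b k}" using k \<open>a \<le> b\<close> by auto
    finally show ?case by blast
  qed
  obtain x3 where x3: "t \<le> x3" "{lo..hi} \<subseteq> D x3" using diags_used[of "{lo..hi}"] by auto
  have "\<exists>a b. D x = {a..b}" if "max s x3 \<le> x" for x
  proof -
    have "{lo..hi} \<subseteq> D x" using x3(2) D_mono[of x3 x] that by auto
    then show ?thesis using inv[of x] that by (simp add: Un_absorb2)
  qed
  then show ?thesis by (intro exI[of _ "max s x3"]) (auto simp: s_def)
qed

section \<open>Diagonals used below a given row\<close>

definition Dr :: "int \<Rightarrow> int set" where
  "Dr y = D0 \<union> (\<lambda>x. w x - x) ` {x. t \<le> x \<and> w x < y}"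

lemma D_fill:
  assumes "finite F"
  shows "\<exists>T>t + 1. F \<subseteq> D T \<and> (\<forall>x\<ge>T. \<exists>a b. D x = {a..b})"
proof -
  obtain T where T: "t + 1 < T" "\<forall>x\<ge>T. \<exists>a b. D x = {a..b}" using D_interval by blast
  obtain x where x: "t \<le> x" "F \<subseteq> D x" using diags_used[OF assms] by blast
  then show ?thesis
    using T D_mono[of x "max T x"] by (intro exI[of _ "max T x"]) auto
qed

text \<open>The columns before \<open>X\<close> of height at least \<open>Y\<close> (the set
  \<open>?Z\<close>) account both for \<open>D X - Dr Y\<close> and for
  \<open>R X - {0..<Y}\<close>. So the two differences have equal size, and \<open>card_D\<close>
  and \<open>card_R\<close> eliminate \<open>X\<close>.\<close>

lemma Dr_card:
  assumes X: "t \<le> X" and Y: "R0 \<subseteq> {0..<Y}" "{0..<Y} \<subseteq> R X" "0 \<le> Y"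
  shows "finite (Dr Y)" "int (card (Dr Y)) = Y + int (card D0) - int (card R0)"
proof -
  have less: "x < X" if "t \<le> x" "w x < Y" for x
  proof (rule ccontr)
    assume "\<not> x < X"
    then have "R X \<subseteq> R x" by (intro R_mono) simp
    moreover have "w x \<in> {0..<Y}" using that w_nonneg by auto
    ultimately show False using w_notin_R[OF that(1)] Y(2) by blast
  qed
  then have sub: "Dr Y \<subseteq> D X" by (auto simp: Dr_def D_def)
  show fin: "finite (Dr Y)" using sub finite_D finite_subset by blast
  let ?Z = "{x. t \<le> x \<and> x < X \<and> Y \<le> w x}"
  have DX: "D X - Dr Y = (\<lambda>x. w x - x) ` ?Z"
  proof
    show "D X - Dr Y \<subseteq> (\<lambda>x. w x - x) ` ?Z" by (force simp: D_def Dr_def)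
    show "(\<lambda>x. w x - x) ` ?Z \<subseteq> D X - Dr Y"
    proof (rule image_subsetI)
      fix x assume x: "x \<in> ?Z"
      then have "w x - x \<notin> D0" using w_diag by auto
      moreover have "w x - x \<noteq> w x' - x'" if "t \<le> x'" "w x' < Y" for x'
        using diag_eq_iff[of x x'] that x by fastforce
      ultimately show "w x - x \<in> D X - Dr Y" using x by (auto simp: D_def Dr_def)
    qed
  qed
  have RX: "R X - {0..<Y} = w ` ?Z"
  proof
    show "R X - {0..<Y} \<subseteq> w ` ?Z" using Y(1) w_nonneg by (force simp: R_def)
    show "w ` ?Z \<subseteq> R X - {0..<Y}" by (auto simp: R_def)
  qed
  have "card (D X - Dr Y) = card ?Z"
    unfolding DX using diag_eq_iff by (intro card_image) (auto simp: inj_on_def)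
  moreover have "card (R X - {0..<Y}) = card ?Z"
    unfolding RX using w_eq_iff by (intro card_image) (auto simp: inj_on_def)
  moreover have "card (D X - Dr Y) = card (D X) - card (Dr Y)"
    by (rule card_Diff_subset[OF fin sub])
  moreover have "card (R X - {0..<Y}) = card (R X) - card {0..<Y}"
    using Y(2) by (intro card_Diff_subset) auto
  ultimately have "int (card (D X)) - int (card (Dr Y)) = int (card (R X)) - int (card {0..<Y})"
    using card_mono[OF finite_D sub] card_mono[OF finite_R Y(2)] by linarith
  then show "int (card (Dr Y)) = Y + int (card D0) - int (card R0)"
    using card_R[OF X] card_D[OF X] Y(3) by simp
qed

lemma Dr_interval: "\<exists>Y0. \<forall>Y\<ge>Y0. 0 \<in> Dr Y \<and> int (card (Dr Y)) = Y + int (card D0) - int (card R0) \<and> (\<exists>a b. Dr Y = {a..b})"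
proof -
  obtain T where T: "t + 1 < T" "{0} \<subseteq> D T" "\<And>x. T \<le> x \<Longrightarrow> \<exists>a b. D x = {a..b}"
    using D_fill[of "{0}"] by auto
  obtain a0 b0 where ab0: "D T = {a0..b0}" using T(3) by blast
  obtain Y0 where Y0: "\<And>y. y \<in> R T \<Longrightarrow> y \<le> Y0"
    using finite_R by (meson bdd_above.E bdd_above_finite)
  have "0 \<in> Dr Y \<and> int (card (Dr Y)) = Y + int (card D0) - int (card R0) \<and> (\<exists>a b. Dr Y = {a..b})"
    if Y: "max 0 (Y0 + 1) \<le> Y" for Y
  proof -
    obtain X where X: "t \<le> X" "{0..<int (nat Y)} \<subseteq> R X" using rows_used by blast
    have RT: "y < Y" if "y \<in> R T" for y using Y0[OF that] Y by linarith
    have "R0 \<subseteq> R T" by (auto simp: R_def)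
    then have "R0 \<subseteq> {0..<Y}" using RT R0_nonneg by auto
    then have fin: "finite (Dr Y)" and card: "int (card (Dr Y)) = Y + int (card D0) - int (card R0)"
      using Dr_card[of X Y] X Y by auto
    have DT: "D T \<subseteq> Dr Y" using RT w_in_R[of _ T] by (force simp: D_def Dr_def)
    have D0T: "D0 \<subseteq> D T" by (auto simp: D_def)
    \<comment> \<open>When \<open>k\<close> was chosen, the interval \<open>D x\<close> reached at
      least to \<open>k - 1\<close>, so \<open>k'\<close> came in an earlier column. Earlier column
      and lower diagonal mean a lower row.\<close>
    have up: "k' \<in> Dr Y" if k: "k \<in> Dr Y" "b0 < k'" "k' < k" for k k'
    proof (cases "k' \<in> D0")
      case True then show ?thesis by (simp add: Dr_def)
    next
      case False
      have kT: "k \<notin> D T" using ab0 k by auto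
      then obtain x where x: "t \<le> x" "w x < Y" "k = w x - x"
        using k(1) D0T by (auto simp: Dr_def)
      have xT: "T \<le> x" using kT x diag_in_D by force
      obtain a b where ab: "D x = {a..b}" using T(3)[OF xT] by blast
      have "{a0..b0} \<subseteq> {a..b}" "0 \<in> {a0..b0}" using D_mono[OF xT] ab ab0 T by auto
      moreover have "k \<le> b + 1" using diag_upper[of x b] ab T xT x by auto
      ultimately have "k' \<in> D x" using ab k by auto
      then obtain x' where x': "t \<le> x'" "x' < x" "k' = w x' - x'"
        using False by (auto simp: D_def)
      then have "w x' < Y" using k x by linarith
      then show ?thesis using x' by (auto simp: Dr_def)
    qed
    have down: "k' \<in> Dr Y" if k: "k \<in> Dr Y" "k' < a0" "k < k'" for k k'
    proof (cases "k' \<in> D T")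
      case True then show ?thesis using DT by blast
    next
      case False
      have kT: "k \<notin> D T" using ab0 k by auto
      then obtain x where x: "t \<le> x" "w x < Y" "k = w x - x"
        using k(1) D0T by (auto simp: Dr_def)
      have xT: "T \<le> x" using kT x diag_in_D by force
      obtain a b where ab: "D x = {a..b}" using T(3)[OF xT] by blast
      have "{a0..b0} \<subseteq> {a..b}" "0 \<in> {a0..b0}" using D_mono[OF xT] ab ab0 T by auto
      moreover have "a - 1 \<le> k" using diag_lower[of x a] ab T xT x by auto
      ultimately have "k' \<in> D x" using ab k by auto
      then obtain x' where x': "t \<le> x'" "x' < x" "k' = w x' - x'"
        using False D0T by (auto simp: D_def)
      have x'T: "T \<le> x'" using False x' diag_in_D[of x' T] by force
      obtain a' b' where ab': "D x' = {a'..b'}" using T(3)[OF x'T] by blast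
      have "{a0..b0} \<subseteq> {a'..b'}" "0 \<in> {a0..b0}" using D_mono[OF x'T] ab' ab0 T by auto
      moreover have "k' \<notin> D x'" using diag_notin_D x' by auto
      ultimately have k'a': "k' < a'" using ab' k by auto
      \<comment> \<open>Here \<open>k'\<close> is the higher diagonal, so minimality is needed:
        otherwise column \<open>x'\<close> would have preferred row \<open>w x\<close>, which was
        free and met a diagonal below all those used by then.\<close>
      have "w x' \<le> w x"
      proof (rule ccontr)
        assume *: "\<not> w x' \<le> w x"
        have "w x \<notin> R x'" using w_notin_R[OF x(1)] R_mono[of x' x] x' by auto
        moreover have "w x - x' \<notin> D x'" using ab' * x' k'a' by auto
        ultimately show False using least[OF x'(1), of "w x"] w_nonneg[OF x(1)] * by blast
      qed
      then show ?thesis using x x' by (auto simp: Dr_def)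
    qed
    have 0: "0 \<in> Dr Y" using DT T by blast
    then have ne: "Dr Y \<noteq> {}" by blast
    have "{Min (Dr Y)..Max (Dr Y)} \<subseteq> Dr Y"
    proof
      fix k assume k: "k \<in> {Min (Dr Y)..Max (Dr Y)}"
      have mm: "Min (Dr Y) \<in> Dr Y" "Max (Dr Y) \<in> Dr Y" using fin ne by auto
      consider "k \<in> D T" | "k < a0" | "b0 < k" using ab0 by fastforce
      then show "k \<in> Dr Y"
      proof cases
        case 1 then show ?thesis using DT by blast
      next
        case 2 then show ?thesis using down[OF mm(1)] mm k by (cases "k = Min (Dr Y)") auto
      next
        case 3 then show ?thesis using up[OF mm(2)] mm k by (cases "k = Max (Dr Y)") auto
      qed
    qed
    moreover have "Dr Y \<subseteq> {Min (Dr Y)..Max (Dr Y)}" using fin by auto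
    ultimately show ?thesis using 0 card by blast
  qed
  then show ?thesis by blast
qed

section \<open>Points indexed by their diagonals\<close>

definition col :: "int \<Rightarrow> int" where "col k = (THE x. t \<le> x \<and> w x - x = k)"

lemma col: assumes "k \<notin> D0" shows "t \<le> col k" "w (col k) = col k + k"
proof -
  obtain x where "t \<le> x" "w x - x = k" using diag_used[of k] assms by (auto simp: D_def)
  then have "\<exists>!x. t \<le> x \<and> w x - x = k" using diag_eq_iff by blast
  from theI'[OF this] show "t \<le> col k" "w (col k) = col k + k" by (auto simp: col_def)
qed

lemma col_eq: "k \<notin> D0 \<Longrightarrow> t \<le> x \<Longrightarrow> w x = x + k \<longleftrightarrow> x = col k"
  using col[of k] diag_eq_iff[of x "col k"] by auto

lemma in_D_iff: "k \<notin> D0 \<Longrightarrow> k \<in> D x \<longleftrightarrow> col k < x"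
  using col[of k] col_eq[of k] by (force simp: D_def)

lemma in_Dr_iff: "k \<notin> D0 \<Longrightarrow> k \<in> Dr y \<longleftrightarrow> col k + k < y"
  using col[of k] col_eq[of k] by (force simp: Dr_def)

lemma col_interlaced:
  "\<exists>K>0. (\<forall>k\<in>D0. \<bar>k\<bar> < K) \<and> (\<forall>p\<ge>K. \<forall>q\<ge>K.
     (col q + (int (card D0) - t) < p + q \<longleftrightarrow> p + q \<le> col (- p) + (int (card D0) - t)) \<and>
     (col q + q + (int (card D0) - int (card R0)) < p + q \<longleftrightarrow>
       p + q \<le> col (- p) - p + (int (card D0) - int (card R0))))"
proof -
  obtain T where T: "t + 1 < T" "{0} \<subseteq> D T" "\<And>x. T \<le> x \<Longrightarrow> \<exists>a b. D x = {a..b}"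
    using D_fill[of "{0}"] by auto
  obtain Y0 where Y0: "\<And>Y. Y0 \<le> Y \<Longrightarrow> 0 \<in> Dr Y \<and>
      int (card (Dr Y)) = Y + int (card D0) - int (card R0) \<and> (\<exists>a b. Dr Y = {a..b})"
    using Dr_interval by blast
  obtain B where B: "\<And>k. k \<in> abs ` D0 \<Longrightarrow> k \<le> B"
    using finite_D0 by (meson bdd_above.E bdd_above_finite finite_imageI)
  \<comment> \<open>Large enough that \<open>q\<close> and \<open>- p\<close> avoid
    \<open>D0\<close> and that \<open>D X\<close> and \<open>Dr Y\<close> below are
    intervals.\<close>
  define K where "K = max 1 (max (B + 1) (max (T + int (card D0) - t) (Y0 + int (card D0) - int (card R0))))"
  have K: "1 \<le> K" "B < K" "T + int (card D0) - t \<le> K" "Y0 + int (card D0) - int (card R0) \<le> K"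
    by (auto simp: K_def)
  have D0K: "\<bar>k\<bar> < K" if "k \<in> D0" for k using B[of "\<bar>k\<bar>"] that K by auto
  have "(col q + (int (card D0) - t) < p + q \<longleftrightarrow> p + q \<le> col (- p) + (int (card D0) - t)) \<and>
     (col q + q + (int (card D0) - int (card R0)) < p + q \<longleftrightarrow>
       p + q \<le> col (- p) - p + (int (card D0) - int (card R0)))"
    if pq: "K \<le> p" "K \<le> q" for p q
  proof -
    have nD: "q \<notin> D0" "- p \<notin> D0" using D0K[of q] D0K[of "- p"] pq by auto
    \<comment> \<open>The source of the translation vector: for these \<open>X\<close> and
      \<open>Y\<close>, both \<open>D X\<close> and \<open>Dr Y\<close> have exactly
      \<open>p + q\<close> elements.\<close>
    define X where "X = p + q - (int (card D0) - t)"
    define Y where "Y = p + q - (int (card D0) - int (card R0))"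
    have X: "T \<le> X" and Y: "Y0 \<le> Y" using K pq by (auto simp: X_def Y_def)
    obtain a b where "{a..b} = D X" using T(3)[OF X] by metis
    moreover have "0 \<in> D X" using T(2) D_mono[OF X] by auto
    moreover have "int (card (D X)) = p + q" using card_D[of X] X T(1) by (simp add: X_def)
    ultimately have 1: "q \<in> D X \<longleftrightarrow> - p \<notin> D X"
      using interval_exactly_one pq K by (metis less_le_trans zero_less_one)
    obtain a b where "{a..b} = Dr Y" using Y0[OF Y] by metis
    moreover have "0 \<in> Dr Y" "int (card (Dr Y)) = p + q" using Y0[OF Y] by (auto simp: Y_def)
    ultimately have 2: "q \<in> Dr Y \<longleftrightarrow> - p \<notin> Dr Y"
      using interval_exactly_one pq K by (metis less_le_trans zero_less_one)
    show ?thesis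
      using 1 2 unfolding in_D_iff[OF nD(1)] in_D_iff[OF nD(2)] in_Dr_iff[OF nD(1)] in_Dr_iff[OF nD(2)]
      by (auto simp: X_def Y_def)
  qed
  then show ?thesis using K D0K by (intro exI[of _ K]) auto
qed

end

section \<open>Altered Wythoff games\<close>

lemma mem_translate: "(x, y) \<in> translate dx dy S \<longleftrightarrow> (x - dx, y - dy) \<in> S"
  unfolding translate_def by force

lemma mem_moves_iff:
  "(a', b') \<in> moves (a, b) \<longleftrightarrow>
     a' < a \<and> b' = b \<or> a' = a \<and> b' < b \<or> a' < a \<and> int b' = int a' + (int b - int a)"
proof
  assume "(a', b') \<in> moves (a, b)"
  then show "a' < a \<and> b' = b \<or> a' = a \<and> b' < b \<or> a' < a \<and> int b' = int a' + (int b - int a)"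
    by (auto simp: moves_def)
next
  assume "a' < a \<and> b' = b \<or> a' = a \<and> b' < b \<or> a' < a \<and> int b' = int a' + (int b - int a)"
  then consider "a' < a" "b' = b" | "a' = a" "b' < b" | "a' < a" "int b' = int a' + (int b - int a)"
    by blast
  then show "(a', b') \<in> moves (a, b)"
  proof cases
    case 1
    then have "(a', b') = (a - (a - a'), b) \<and> 1 \<le> a - a' \<and> a - a' \<le> a" by auto
    then show ?thesis unfolding moves_def by blast
  next
    case 2
    then have "(a', b') = (a, b - (b - b')) \<and> 1 \<le> b - b' \<and> b - b' \<le> b" by auto
    then show ?thesis unfolding moves_def by blast
  next
    case 3
    then have "(a', b') = (a - (a - a'), b - (a - a')) \<and> 1 \<le> a - a' \<and> a - a' \<le> a \<and> a - a' \<le> b"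
      by auto
    then show ?thesis unfolding moves_def by blast
  qed
qed

lemma mem_P_positions: "(int a, int b) \<in> P_positions P N \<longleftrightarrow> label_of P N (a, b) = PLabel"
  by (auto simp: P_positions_def)

lemma P_positions_nonneg: "(x, y) \<in> P_positions P N \<Longrightarrow> 0 \<le> x \<and> 0 \<le> y"
  by (auto simp: P_positions_def)

text \<open>The integer quantifiers may run over negative coordinates because no P-positions occur
  there.\<close>

lemma P_positions_rec:
  assumes "(a, b) \<notin> P \<union> N"
  shows "(int a, int b) \<in> P_positions P N \<longleftrightarrow>
    (\<forall>x<int a. (x, int b) \<notin> P_positions P N) \<and> (\<forall>y<int b. (int a, y) \<notin> P_positions P N) \<and>
    (\<forall>x<int a. (x, x + (int b - int a)) \<notin> P_positions P N)"
    (is "?L \<longleftrightarrow> ?r")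
proof -
  have "?L \<longleftrightarrow> (\<forall>q\<in>moves (a, b). label_of P N q \<noteq> PLabel)"
    unfolding mem_P_positions using assms by (subst label_of.simps) auto
  also have "\<dots> \<longleftrightarrow> (\<forall>a' b'. (a', b') \<in> moves (a, b) \<longrightarrow> (int a', int b') \<notin> P_positions P N)"
    by (auto simp: mem_P_positions)
  also have "\<dots> \<longleftrightarrow> ?r"
  proof
    assume L: "\<forall>a' b'. (a', b') \<in> moves (a, b) \<longrightarrow> (int a', int b') \<notin> P_positions P N"
    have "(x, y) \<notin> P_positions P N"
      if "x < int a \<and> y = int b \<or> x = int a \<and> y < int b \<or> x < int a \<and> y = x + (int b - int a)" for x y
    proof
      assume xy: "(x, y) \<in> P_positions P N"
      then obtain a' b' where ab: "x = int a'" "y = int b'" by (auto simp: P_positions_def)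
      with that have "(a', b') \<in> moves (a, b)" unfolding mem_moves_iff by auto
      then show False using L xy ab by blast
    qed
    then show ?r by blast
  next
    assume ?r
    then show "\<forall>a' b'. (a', b') \<in> moves (a, b) \<longrightarrow> (int a', int b') \<notin> P_positions P N"
      unfolding mem_moves_iff by (metis of_nat_less_iff)
  qed
  finally show ?thesis .
qed

text \<open>Apart from forced positions a column has at most one P-position, since the upper of two
  would have a move to the lower.\<close>

lemma finite_P_positions_columns:
  assumes "finite P"
  shows "finite {(x, y) \<in> P_positions P N. x < s}"
proof -
  let ?P = "(\<lambda>(a, b). (int a, int b)) ` P"
  let ?S = "{(x, y) \<in> P_positions P N. x < s} - ?P"
  have unforced: "(a, b) \<notin> P \<union> N" if "(int a, int b) \<in> P_positions P N - ?P" for a b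
  proof -
    have 1: "(a, b) \<notin> P" using that by force
    moreover have "(a, b) \<notin> N"
      using that 1 unfolding Diff_iff mem_P_positions by (subst (asm) label_of.simps) auto
    ultimately show ?thesis by blast
  qed
  have "inj_on fst ?S"
  proof (rule inj_onI)
    fix z z' assume zz: "z \<in> ?S" "z' \<in> ?S" "fst z = fst z'"
    then obtain a b b' where ab: "z = (int a, int b)" "z' = (int a, int b')"
      by (auto simp: P_positions_def)
    have in_A: "(int a, int b) \<in> P_positions P N - ?P" "(int a, int b') \<in> P_positions P N - ?P"
      using zz(1,2) unfolding ab by blast+
    have "\<forall>y<int b. (int a, y) \<notin> P_positions P N" "\<forall>y<int b'. (int a, y) \<notin> P_positions P N"
      using P_positions_rec[OF unforced[OF in_A(1)]] P_positions_rec[OF unforced[OF in_A(2)]] in_A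
      by blast+
    then have "\<not> int b < int b'" "\<not> int b' < int b" using in_A by blast+
    then show "z = z'" using ab by simp
  qed
  have "fst ` ?S \<subseteq> {0..<s}" by (auto dest: P_positions_nonneg)
  then have "finite (fst ` ?S)" by (rule finite_subset) simp
  then have "finite ?S" using \<open>inj_on fst ?S\<close> by (rule finite_imageD)
  then show ?thesis using assms by simp
qed

section \<open>Altered games as greedy placement\<close>

locale altered_wythoff =
  fixes P N :: "(nat \<times> nat) set" and t :: nat
  assumes finite_P: "finite P" and forced_columns: "(a, b) \<in> P \<union> N \<Longrightarrow> a < t"
begin

definition A :: "(int \<times> int) set" where "A = P_positions P N"

definition height :: "int \<Rightarrow> int" where "height x = (THE y. (x, y) \<in> A)"

definition rows :: "int set" where "rows = {y. \<exists>x. (x, y) \<in> A \<and> x \<le> int t - 1}"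

definition diags :: "int set" where "diags = {k. \<exists>x y. (x, y) \<in> A \<and> x \<le> int t - 1 \<and> y - x = k}"

lemma A_nonneg: "(x, y) \<in> A \<Longrightarrow> 0 \<le> x" "(x, y) \<in> A \<Longrightarrow> 0 \<le> y"
  using P_positions_nonneg by (auto simp: A_def)

lemma finite_columns: "finite {(x, y) \<in> A. x < s}"
  unfolding A_def by (rule finite_P_positions_columns[OF finite_P])

lemma A_rec:
  assumes "int t \<le> x" "0 \<le> y"
  shows "(x, y) \<in> A \<longleftrightarrow> (\<forall>x'<x. (x', y) \<notin> A) \<and> (\<forall>y'<y. (x, y') \<notin> A) \<and>
    (\<forall>x'<x. (x', x' + (y - x)) \<notin> A)"
proof -
  have "(nat x, nat y) \<notin> P \<union> N" using forced_columns[of "nat x" "nat y"] assms by auto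
  from P_positions_rec[OF this] show ?thesis using assms by (simp add: A_def)
qed

lemma finite_rows_before: "finite {y. \<exists>x'<x. (x', y) \<in> A}"
proof -
  have "{y. \<exists>x'<x. (x', y) \<in> A} = snd ` {(x', y) \<in> A. x' < x}" by force
  then show ?thesis using finite_columns by simp
qed

lemma finite_diags_before: "finite {k. \<exists>x'<x. (x', x' + k) \<in> A}"
proof -
  have "{k. \<exists>x'<x. (x', x' + k) \<in> A} \<subseteq> (\<lambda>(x, y). y - x) ` {(x', y) \<in> A. x' < x}" by force
  then show ?thesis using finite_columns finite_surj by blast
qed

lemma column_unique:
  assumes "int t \<le> x" shows "\<exists>!y. (x, y) \<in> A"
proof -
  \<comment> \<open>Finitely many P-positions lie left of column \<open>x\<close>, so some square of
    the column is not attacked from there; the least such square is the P-position.\<close>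
  define free where "free n \<longleftrightarrow> (\<forall>x'<x. (x', int n) \<notin> A) \<and> (\<forall>x'<x. (x', x' + (int n - x)) \<notin> A)" for n
  have "finite {n. \<not> free n}"
  proof -
    have "{n. \<not> free n} \<subseteq> int -` {y. \<exists>x'<x. (x', y) \<in> A} \<union>
        (\<lambda>n. int n - x) -` {k. \<exists>x'<x. (x', x' + k) \<in> A}"
      by (auto simp: free_def)
    moreover have "finite (int -` {y. \<exists>x'<x. (x', y) \<in> A} \<union>
        (\<lambda>n. int n - x) -` {k. \<exists>x'<x. (x', x' + k) \<in> A})"
      by (intro finite_UnI finite_vimageI finite_rows_before finite_diags_before) (auto simp: inj_on_def)
    ultimately show ?thesis by (rule finite_subset)
  qed
  then have "\<exists>n. free n" by (metis (mono_tags, lifting) UNIV_eq_I infinite_UNIV_nat mem_Collect_eq)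
  then obtain n where n: "free n" "\<And>m. m < n \<Longrightarrow> \<not> free m" by (metis LeastI not_less_Least)
  have "(x, y') \<notin> A" if "y' < int n" for y'
  proof
    assume y': "(x, y') \<in> A"
    then have "0 \<le> y'" by (rule A_nonneg)
    then have "free (nat y')" using y' A_rec[OF assms, of y'] by (simp add: free_def)
    then show False using n(2)[of "nat y'"] that \<open>0 \<le> y'\<close> by linarith
  qed
  then have "(x, int n) \<in> A" using n(1) A_rec[OF assms, of "int n"] by (simp add: free_def)
  moreover have "y = y'" if "(x, y) \<in> A" "(x, y') \<in> A" for y y'
    using A_rec[OF assms, of y] A_rec[OF assms, of y'] that A_nonneg by (metis linorder_neqE)
  ultimately show ?thesis by blast
qed

lemma height_iff: "int t \<le> x \<Longrightarrow> (x, y) \<in> A \<longleftrightarrow> y = height x"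
  using theI'[OF column_unique, of x] column_unique[of x] unfolding height_def by blast

lemma rows_before:
  assumes "int t \<le> x"
  shows "y \<in> rows \<union> height ` {int t..<x} \<longleftrightarrow> (\<exists>x'<x. (x', y) \<in> A)"
proof
  assume "y \<in> rows \<union> height ` {int t..<x}"
  then show "\<exists>x'<x. (x', y) \<in> A"
  proof
    assume "y \<in> rows"
    then show ?thesis using assms by (force simp: rows_def)
  next
    assume "y \<in> height ` {int t..<x}"
    then show ?thesis using height_iff by auto
  qed
next
  assume "\<exists>x'<x. (x', y) \<in> A"
  then obtain x' where "x' < x" "(x', y) \<in> A" by blast
  then show "y \<in> rows \<union> height ` {int t..<x}"
    using height_iff[of x' y] by (cases "x' < int t") (auto simp: rows_def)
qed

lemma diags_before:
  assumes "int t \<le> x"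
  shows "k \<in> diags \<union> (\<lambda>x'. height x' - x') ` {int t..<x} \<longleftrightarrow> (\<exists>x'<x. (x', x' + k) \<in> A)"
proof
  assume "k \<in> diags \<union> (\<lambda>x'. height x' - x') ` {int t..<x}"
  then show "\<exists>x'<x. (x', x' + k) \<in> A"
  proof
    assume "k \<in> diags"
    then obtain x' y where "(x', y) \<in> A" "x' \<le> int t - 1" "y - x' = k" unfolding diags_def by blast
    then show ?thesis using assms by (intro exI[of _ x']) auto
  next
    assume "k \<in> (\<lambda>x'. height x' - x') ` {int t..<x}"
    then obtain x' where "int t \<le> x'" "x' < x" "k = height x' - x'" by auto
    then show ?thesis using height_iff[of x' "x' + k"] by auto
  qed
next
  assume "\<exists>x'<x. (x', x' + k) \<in> A"
  then obtain x' where x': "x' < x" "(x', x' + k) \<in> A" by blast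
  show "k \<in> diags \<union> (\<lambda>x'. height x' - x') ` {int t..<x}"
  proof (cases "x' < int t")
    case True
    then show ?thesis using x' unfolding diags_def by fastforce
  next
    case False
    then have "k = height x' - x'" using x' height_iff[of x' "x' + k"] by simp
    then show ?thesis using False x' by auto
  qed
qed

sublocale greedy "int t" rows diags height
proof
  show "0 \<le> int t" by simp
  have "rows = snd ` {(x, y) \<in> A. x < int t}" by (force simp: rows_def)
  then show "finite rows" using finite_columns by simp
  have "diags \<subseteq> (\<lambda>(x, y). y - x) ` {(x, y) \<in> A. x < int t}" by (force simp: diags_def)
  then show "finite diags" using finite_columns finite_surj by blast
  show "0 \<le> y" if "y \<in> rows" for y using that A_nonneg by (auto simp: rows_def)
  show "\<exists>k\<in>diags. y < int t + k" if y: "y \<in> rows" for y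
  proof -
    obtain x where "(x, y) \<in> A" "x \<le> int t - 1" using y by (auto simp: rows_def)
    then have "y - x \<in> diags" "y < int t + (y - x)" by (auto simp: diags_def)
    then show ?thesis by blast
  qed
  fix x assume x: "int t \<le> x"
  have h: "(x, height x) \<in> A" using height_iff[OF x] by simp
  show h0: "0 \<le> height x" using A_nonneg(2)[OF h] .
  show "height x \<notin> rows \<union> height ` {int t..<x}"
    unfolding rows_before[OF x] using A_rec[OF x h0] h by blast
  show "height x - x \<notin> diags \<union> (\<lambda>x'. height x' - x') ` {int t..<x}"
    unfolding diags_before[OF x] using A_rec[OF x h0] h by blast
  fix y assume y: "0 \<le> y" "y \<notin> rows \<union> height ` {int t..<x}"
      "y - x \<notin> diags \<union> (\<lambda>x'. height x' - x') ` {int t..<x}"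
  show "height x \<le> y"
  proof (rule ccontr)
    assume "\<not> height x \<le> y"
    then have "(x, y') \<notin> A" if "y' \<le> y" for y' using height_iff[OF x, of y'] that by auto
    then show False
      using A_rec[OF x y(1)] y(2,3) unfolding rows_before[OF x] diags_before[OF x] by auto
  qed
qed

lemma A_diag_iff:
  assumes "k \<notin> diags" shows "(x, x + k) \<in> A \<longleftrightarrow> x = col k"
proof (cases "int t \<le> x")
  case True
  then show ?thesis using height_iff[OF True, of "x + k"] col_eq[OF assms True] by auto
next
  case False
  then have "(x, x + k) \<notin> A" using assms diags_before[of "int t" k] by auto
  then show ?thesis using False col(1)[OF assms] by auto
qed

lemma finite_A_diag: "finite {x. (x, x + k) \<in> A}"
proof (rule finite_subset)
  show "{x. (x, x + k) \<in> A} \<subseteq> fst ` {(x, y) \<in> A. x < int t} \<union> {x. int t \<le> x \<and> height x - x = k}"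
  proof
    fix x assume "x \<in> {x. (x, x + k) \<in> A}"
    then have x: "(x, x + k) \<in> A" by simp
    show "x \<in> fst ` {(x, y) \<in> A. x < int t} \<union> {x. int t \<le> x \<and> height x - x = k}"
    proof (cases "x < int t")
      case True then show ?thesis using x by force
    next
      case False then show ?thesis using height_iff[of x "x + k"] x by auto
    qed
  qed
  have "finite {x. int t \<le> x \<and> height x - x = k}"
    by (rule finite_imageD[where f = "\<lambda>x. height x - x"])
       (auto simp: inj_on_def diag_eq_iff intro: finite_subset[of _ "{k}"])
  then show "finite (fst ` {(x, y) \<in> A. x < int t} \<union> {x. int t \<le> x \<and> height x - x = k})"
    using finite_columns by simp
qed

lemma interlaced_tails_translate:
  "\<exists>K u v. interlaced_tails K u v
     (translate (int (card diags) - int t) (int (card diags) - int (card rows)) A)"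
proof -
  let ?dx = "int (card diags) - int t" and ?dy = "int (card diags) - int (card rows)"
  \<comment> \<open>The translation moves diagonal \<open>q + h\<close> to diagonal
    \<open>q\<close>. The shifts of \<open>q\<close> and \<open>p\<close> cancel in
    \<open>p + q\<close>, so the equivalences of \<open>col_interlaced\<close> carry over.\<close>
  define h where "h = ?dx - ?dy"
  obtain K where K: "0 < K" "\<And>k. k \<in> diags \<Longrightarrow> \<bar>k\<bar> < K"
    and il: "\<And>p q. K \<le> p \<Longrightarrow> K \<le> q \<Longrightarrow>
      (col q + ?dx < p + q \<longleftrightarrow> p + q \<le> col (- p) + ?dx) \<and>
      (col q + q + ?dy < p + q \<longleftrightarrow> p + q \<le> col (- p) - p + ?dy)"
    using col_interlaced by blast
  define u where "u q = col (q + h) + ?dx" for q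
  define v where "v p = col (- (p - h)) - (p - h) + ?dy" for p
  have nd: "k \<notin> diags" if "K \<le> \<bar>k\<bar>" for k using K(2)[of k] that by force
  have "interlaced (K + \<bar>h\<bar>) u v"
    unfolding interlaced_def
  proof (intro allI impI)
    fix p q assume "K + \<bar>h\<bar> \<le> p" "K + \<bar>h\<bar> \<le> q"
    then have "K \<le> p - h" "K \<le> q + h" by linarith+
    from il[OF this] show "(u q < p + q \<longleftrightarrow> q \<le> v p) \<and> (u q < p \<longleftrightarrow> p + q \<le> v p)"
      unfolding u_def v_def h_def by (auto simp: algebra_simps)
  qed
  moreover have "(x, x + q) \<in> translate ?dx ?dy A \<longleftrightarrow> x = u q" if "K + \<bar>h\<bar> \<le> q" for x q
  proof -
    have "q + h \<notin> diags" using that by (intro nd) linarith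
    from A_diag_iff[OF this, of "x - ?dx"] show ?thesis
      by (auto simp: mem_translate u_def h_def algebra_simps)
  qed
  moreover have "(y + p, y) \<in> translate ?dx ?dy A \<longleftrightarrow> y = v p" if "K + \<bar>h\<bar> \<le> p" for y p
  proof -
    have "- (p - h) \<notin> diags" using that by (intro nd) linarith
    from A_diag_iff[OF this, of "y + p - ?dx"] show ?thesis
      by (auto simp: mem_translate v_def h_def algebra_simps)
  qed
  moreover have "finite {x. (x, x + k) \<in> translate ?dx ?dy A}" for k
  proof -
    have "{x. (x, x + k) \<in> translate ?dx ?dy A} \<subseteq> (\<lambda>x. x + ?dx) ` {x. (x, x + (k + h)) \<in> A}"
    proof
      fix x assume "x \<in> {x. (x, x + k) \<in> translate ?dx ?dy A}"
      then have "x - ?dx \<in> {x. (x, x + (k + h)) \<in> A}"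
        by (auto simp: mem_translate h_def algebra_simps)
      then show "x \<in> (\<lambda>x. x + ?dx) ` {x. (x, x + (k + h)) \<in> A}"
        by (intro image_eqI[of _ _ "x - ?dx"]) auto
    qed
    then show ?thesis using finite_A_diag finite_surj by blast
  qed
  ultimately have "interlaced_tails (K + \<bar>h\<bar>) u v (translate ?dx ?dy A)"
    using K(1) unfolding interlaced_tails_def by auto
  then show ?thesis by blast
qed

end

theorem theorem3:
  fixes P N :: "(nat \<times> nat) set"
    and A B :: "(int \<times> int) set"
    and t c r d :: nat
  assumes "finite P" and "finite N" and "P \<inter> N = {}" and "P \<union> N \<noteq> {}"
    and "A = P_positions P N"
    and "B = P_positions {} {}"
    and "t = Max (fst ` (P \<union> N)) + 1"
    and "c = t"
    and "r = card {y. \<exists>x. (x, y) \<in> A \<and> x \<le> int t - 1}"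
    and "d = card {k. \<exists>x y. (x, y) \<in> A \<and> x \<le> int t - 1 \<and> y - x = k}"
  shows "asymptotically_equal (translate (int d - int c) (int d - int r) A) B"
proof -
  interpret A: altered_wythoff P N t
  proof
    show "finite P" by (rule assms(1))
    fix a b assume "(a, b) \<in> P \<union> N"
    then have "a \<in> fst ` (P \<union> N)" by force
    then have "a \<le> Max (fst ` (P \<union> N))" using assms(1,2) by simp
    then show "a < t" using assms(7) by simp
  qed
  interpret B: altered_wythoff "{}" "{}" 0
    by standard auto
  have A: "A.A = A" "card A.rows = r" "card A.diags = d"
    using assms(5,9,10) by (auto simp: A.A_def A.rows_def A.diags_def)
  \<comment> \<open>For \<open>t = 0\<close> no column precedes, so both counts vanish and the
    translation is trivial.\<close>
  have "B.rows = {}" "B.diags = {}"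
    using B.A_nonneg(1) by (fastforce simp: B.rows_def B.diags_def)+
  moreover have "translate 0 0 S = S" for S by (auto simp: translate_def)
  ultimately have B: "\<exists>K u v. interlaced_tails K u v B"
    using B.interlaced_tails_translate assms(6) by (simp add: B.A_def)
  show ?thesis
    using A.interlaced_tails_translate B interlaced_tails_asymptotically_equal assms(8)
    unfolding A by blast
qed

end
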